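(* Let $(Q,\cdot)$ be a loop with two-sided inverses and with the self-map $\sigma:x\mapsto(xg^{-1})^{-1}$ for all $x\in Q$ and some $g\in Q$. Assume $T_3(Q)\le AUM(Q,\cdot)$ and let $(H,\circ)$ be the $T_3$-holomorph of $(Q,\cdot)$, equipped with the self-map $\sigma'(\alpha,x)=\big(\alpha,(xg^{-1})^{-1}\big)$ for all $(\alpha,x)\in H$. If $(Q,\cdot)$ is a $\sigma\alpha\gamma^{-1}$-generalised flexible-Bol loop for all $\alpha,\gamma\in T_3(Q)$, then $(H,\circ)$ is a $\sigma'$-generalised flexible-Bol loop.
   Context: Juxtaposition binds more tightly than $\cdot$. Permutations are written on the right of their arguments and composed left to right; $yL_x=x\cdot y$, $yR_x=y\cdot x$; $e$ is the identity; $SYM(Q)$ is the group of all permutations of $Q$ and $AUM(Q,\cdot)$ the automorphism group. A loop $(L,\cdot)$ with self-map $\sigma$ is a $\sigma$-generalised (right) Bol loop if $(xy\cdot z)\sigma(y)=x(yz\cdot\sigma(y))$ for all $x,y,z\in L$. $(A,B,C)\in AUT(Q,\cdot)$ means $A,B,C$ are bijections of $Q$ with $xA\cdot yB=(x\cdot y)C$ for all $x,y$. $BS(Q,\cdot)=\{\theta\in SYM(Q):\exists f,g\in Q,\ (\theta R_g^{-1},\theta L_f^{-1},\theta)\in AUT(Q,\cdot)\}$. Permutations $\alpha,\beta\in SYM(Q)$ are twin maps (twins of each other) if $\alpha=\psi R_x$, $\beta=\psi R_y$ for some $x,y\in Q$, $\psi\in SYM(Q)$; each is then called a twin map. $TBS_1(Q,\cdot)$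 is the set of all twin maps in $SYM(Q)$; $TBS_2(Q,\cdot)=BS(Q,\cdot)\cap TBS_1(Q,\cdot)$; $T_2(Q)=\{\psi\in SYM(Q): e\psi=e \text{ and } \psi R_x\in TBS_2(Q,\cdot)\text{ for some }x\in Q\}$. Write $\alpha\sim\beta$ if $\alpha^{-1}=R_x\beta^{-1}$ for some $x\in Q$. $T_3(Q)=\{\psi\in T_2(Q): \alpha^{-1}\sim\beta^{-1}\text{ for any twin maps }\alpha,\beta\in SYM(Q)\}$. When $T_3(Q)\le AUM(Q,\cdot)$, the $T_3$-holomorph is $H=T_3(Q)\times Q$ with $(\alpha,x)\circ(\beta,y)=(\alpha\beta,\,x\beta\cdot y)$, a loop. Flexibility: $(Q,\cdot)$ with self-map $\sigma$ is $\sigma$-flexible if, for some $\delta\in T_3(Q)$, $xy\cdot\sigma(x\delta)=x\cdot y\sigma(x\delta)$ for all $x,y\in Q$. $(H,\circ)$ with self-map $\sigma'$ is $\sigma'$-flexible if $(h\circ k)\circ\sigma'(h)=h\circ(k\circ\sigma'(h))$ for all $h,k\in H$. A loop ($Q$ or $H$) that is both $\sigma$-generalised Bol and $\sigma$-flexible (respectively with $\sigma'$) is a $\sigma$-generalised flexible-Bol loop. When automorphisms are composed with $\sigma$, left function notation is used with $\alpha(x)=x\alpha$: $\sigma\alpha\gamma^{-1}(x)=\sigma(\alpha(\gamma^{-1}(x)))=\sigma((x\gamma^{-1})\alpha)$. *)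

theory Defs
  imports "HOL-Algebra.Bij"
begin

section \<open>Loops\<close>

locale loop =
  fixes Q (structure)
  assumes m_closed: "\<lbrakk>x \<in> carrier Q; y \<in> carrier Q\<rbrakk> \<Longrightarrow> x \<otimes> y \<in> carrier Q"
    and one_closed: "\<one> \<in> carrier Q"
    and l_one: "x \<in> carrier Q \<Longrightarrow> \<one> \<otimes> x = x"
    and r_one: "x \<in> carrier Q \<Longrightarrow> x \<otimes> \<one> = x"
    and l_div: "\<lbrakk>a \<in> carrier Q; b \<in> carrier Q\<rbrakk> \<Longrightarrow> \<exists>!x. x \<in> carrier Q \<and> a \<otimes> x = b"
    and r_div: "\<lbrakk>a \<in> carrier Q; b \<in> carrier Q\<rbrakk> \<Longrightarrow> \<exists>!x. x \<in> carrier Q \<and> x \<otimes> a = b"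

text \<open>When every element is a unit, the library's \<open>inv\<^bsub>Q\<^esub> x\<close> is the (in a loop necessarily
  unique) two-sided inverse of \<open>x\<close>.\<close>

locale loop_with_inverses = loop +
  assumes two_sided_inverses: "carrier Q \<subseteq> Units Q"

section \<open>Permutations, translations and autotopisms\<close>

text \<open>Permutations are the extensional bijections of the carrier, as in the library's
  \<open>BijGroup\<close>.  The multiplication of \<open>BijGroup\<close> is ordinary composition, whereas permutations
  here are written on the right of their arguments and composed left to right: \<open>rprod Q \<alpha> \<beta>\<close>
  stands for \<open>\<alpha>\<beta>\<close>, i.e. first \<open>\<alpha>\<close>, then \<open>\<beta>\<close>.  The image \<open>x\<alpha>\<close> is \<open>\<alpha> x\<close>.\<close>

abbreviation SYM :: "('a, 'b) monoid_scheme \<Rightarrow> ('a \<Rightarrow> 'a) monoid"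
  where "SYM Q \<equiv> BijGroup (carrier Q)"

definition rprod :: "('a, 'b) monoid_scheme \<Rightarrow> ('a \<Rightarrow> 'a) \<Rightarrow> ('a \<Rightarrow> 'a) \<Rightarrow> 'a \<Rightarrow> 'a"
  where "rprod Q \<alpha> \<beta> = \<beta> \<otimes>\<^bsub>SYM Q\<^esub> \<alpha>"

definition L_map :: "('a, 'b) monoid_scheme \<Rightarrow> 'a \<Rightarrow> 'a \<Rightarrow> 'a"
  where "L_map Q x = (\<lambda>y\<in>carrier Q. x \<otimes>\<^bsub>Q\<^esub> y)"

definition R_map :: "('a, 'b) monoid_scheme \<Rightarrow> 'a \<Rightarrow> 'a \<Rightarrow> 'a"
  where "R_map Q x = (\<lambda>y\<in>carrier Q. y \<otimes>\<^bsub>Q\<^esub> x)"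

definition autotopism ::
    "('a, 'b) monoid_scheme \<Rightarrow> ('a \<Rightarrow> 'a) \<Rightarrow> ('a \<Rightarrow> 'a) \<Rightarrow> ('a \<Rightarrow> 'a) \<Rightarrow> bool"
  where "autotopism Q A B C \<longleftrightarrow>
    A \<in> carrier (SYM Q) \<and> B \<in> carrier (SYM Q) \<and> C \<in> carrier (SYM Q) \<and>
    (\<forall>x\<in>carrier Q. \<forall>y\<in>carrier Q. A x \<otimes>\<^bsub>Q\<^esub> B y = C (x \<otimes>\<^bsub>Q\<^esub> y))"

definition BS :: "('a, 'b) monoid_scheme \<Rightarrow> ('a \<Rightarrow> 'a) set"
  where "BS Q = {\<theta> \<in> carrier (SYM Q). \<exists>f\<in>carrier Q. \<exists>g\<in>carrier Q.
    autotopism Q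
      (rprod Q \<theta> (inv\<^bsub>SYM Q\<^esub> (R_map Q g)))
      (rprod Q \<theta> (inv\<^bsub>SYM Q\<^esub> (L_map Q f)))
      \<theta>}"

section \<open>Twin maps\<close>

definition twins :: "('a, 'b) monoid_scheme \<Rightarrow> ('a \<Rightarrow> 'a) \<Rightarrow> ('a \<Rightarrow> 'a) \<Rightarrow> bool"
  where "twins Q \<alpha> \<beta> \<longleftrightarrow> (\<exists>\<psi>\<in>carrier (SYM Q). \<exists>x\<in>carrier Q. \<exists>y\<in>carrier Q.
    \<alpha> = rprod Q \<psi> (R_map Q x) \<and> \<beta> = rprod Q \<psi> (R_map Q y))"

definition twin_rel :: "('a, 'b) monoid_scheme \<Rightarrow> ('a \<Rightarrow> 'a) \<Rightarrow> ('a \<Rightarrow> 'a) \<Rightarrow> bool"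
  where "twin_rel Q \<alpha> \<beta> \<longleftrightarrow>
    (\<exists>x\<in>carrier Q. inv\<^bsub>SYM Q\<^esub> \<alpha> = rprod Q (R_map Q x) (inv\<^bsub>SYM Q\<^esub> \<beta>))"

definition TBS1 :: "('a, 'b) monoid_scheme \<Rightarrow> ('a \<Rightarrow> 'a) set"
  where "TBS1 Q = {\<alpha> \<in> carrier (SYM Q). \<exists>\<beta>\<in>carrier (SYM Q). twins Q \<alpha> \<beta>}"

definition TBS2 :: "('a, 'b) monoid_scheme \<Rightarrow> ('a \<Rightarrow> 'a) set"
  where "TBS2 Q = BS Q \<inter> TBS1 Q"

definition T2 :: "('a, 'b) monoid_scheme \<Rightarrow> ('a \<Rightarrow> 'a) set"
  where "T2 Q = {\<psi> \<in> carrier (SYM Q). \<psi> \<one>\<^bsub>Q\<^esub> = \<one>\<^bsub>Q\<^esub> \<and>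
    (\<exists>x\<in>carrier Q. rprod Q \<psi> (R_map Q x) \<in> TBS2 Q)}"

text \<open>The set \<open>T\<^sub>3(Q)\<close> is commonly written as
  \<open>{\<psi> \<in> T\<^sub>2(Q). \<alpha>\<^sup>-\<^sup>1 \<sim> \<beta>\<^sup>-\<^sup>1 for any twin maps \<alpha>, \<beta> \<in> SYM(Q)}\<close>, where the condition does not mention
  \<open>\<psi>\<close>.  \<open>T3\<close> is this verbatim: the condition ranges over all pairs of twins.  Since that forces
  the right translations to be closed under conjugation in the whole symmetric group, \<open>T3 Q\<close> is
  empty for all but very small \<open>Q\<close>.  \<open>T3_own\<close> is the other possible reading, in which \<open>\<alpha>\<close> and
  \<open>\<beta>\<close> are the twin maps \<open>\<psi>R\<^sub>x\<close>, \<open>\<psi>R\<^sub>y\<close> arising from the given \<open>\<psi>\<close>.\<close>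

definition T3 :: "('a, 'b) monoid_scheme \<Rightarrow> ('a \<Rightarrow> 'a) set"
  where "T3 Q = {\<psi> \<in> T2 Q. \<forall>\<alpha>\<in>carrier (SYM Q). \<forall>\<beta>\<in>carrier (SYM Q).
    twins Q \<alpha> \<beta> \<longrightarrow> twin_rel Q (inv\<^bsub>SYM Q\<^esub> \<alpha>) (inv\<^bsub>SYM Q\<^esub> \<beta>)}"

definition T3_own :: "('a, 'b) monoid_scheme \<Rightarrow> ('a \<Rightarrow> 'a) set"
  where "T3_own Q = {\<psi> \<in> T2 Q. \<forall>x\<in>carrier Q. \<forall>y\<in>carrier Q.
    twin_rel Q (inv\<^bsub>SYM Q\<^esub> (rprod Q \<psi> (R_map Q x))) (inv\<^bsub>SYM Q\<^esub> (rprod Q \<psi> (R_map Q y)))}"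

section \<open>Holomorphs and generalised flexible-Bol loops\<close>

definition holomorph ::
    "('a \<Rightarrow> 'a) set \<Rightarrow> ('a, 'b) monoid_scheme \<Rightarrow> (('a \<Rightarrow> 'a) \<times> 'a) monoid"
  where "holomorph T Q =
    \<lparr>carrier = T \<times> carrier Q,
     mult = (\<lambda>(\<alpha>, x) (\<beta>, y). (rprod Q \<alpha> \<beta>, \<beta> x \<otimes>\<^bsub>Q\<^esub> y)),
     one = (\<one>\<^bsub>SYM Q\<^esub>, \<one>\<^bsub>Q\<^esub>)\<rparr>"

definition generalised_bol_loop :: "('a, 'b) monoid_scheme \<Rightarrow> ('a \<Rightarrow> 'a) \<Rightarrow> bool"
  where "generalised_bol_loop L \<sigma> \<longleftrightarrow> loop L \<and> \<sigma> \<in> carrier L \<rightarrow> carrier L \<and>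
    (\<forall>x\<in>carrier L. \<forall>y\<in>carrier L. \<forall>z\<in>carrier L.
      ((x \<otimes>\<^bsub>L\<^esub> y) \<otimes>\<^bsub>L\<^esub> z) \<otimes>\<^bsub>L\<^esub> \<sigma> y = x \<otimes>\<^bsub>L\<^esub> ((y \<otimes>\<^bsub>L\<^esub> z) \<otimes>\<^bsub>L\<^esub> \<sigma> y))"

text \<open>There are two notions of flexibility: for the base loop, the argument of the self-map may
  be twisted by some \<open>\<delta> \<in> T\<close> (with \<open>T = T\<^sub>3(Q)\<close>); for the holomorph there is no twist.\<close>

definition twisted_flexible ::
    "('a \<Rightarrow> 'a) set \<Rightarrow> ('a, 'b) monoid_scheme \<Rightarrow> ('a \<Rightarrow> 'a) \<Rightarrow> bool"
  where "twisted_flexible T Q \<sigma> \<longleftrightarrow> (\<exists>\<delta>\<in>T. \<forall>x\<in>carrier Q. \<forall>y\<in>carrier Q.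
    (x \<otimes>\<^bsub>Q\<^esub> y) \<otimes>\<^bsub>Q\<^esub> \<sigma> (\<delta> x) = x \<otimes>\<^bsub>Q\<^esub> (y \<otimes>\<^bsub>Q\<^esub> \<sigma> (\<delta> x)))"

definition flexible :: "('a, 'b) monoid_scheme \<Rightarrow> ('a \<Rightarrow> 'a) \<Rightarrow> bool"
  where "flexible H \<sigma> \<longleftrightarrow> (\<forall>h\<in>carrier H. \<forall>k\<in>carrier H.
    (h \<otimes>\<^bsub>H\<^esub> k) \<otimes>\<^bsub>H\<^esub> \<sigma> h = h \<otimes>\<^bsub>H\<^esub> (k \<otimes>\<^bsub>H\<^esub> \<sigma> h))"

end

theory Submission
  imports Defs
begin

text \<open>The Bol identity for the holomorph is a matter of unwinding the multiplication, using
  that the elements of \<open>T\<close> are automorphisms.  Comparing second components for \<open>(\<alpha>, x)\<close>, \<open>(\<beta>, y)\<close>, \<open>(\<gamma>, z)\<close> leaves the identity of \<open>Q\<close> at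
  \<open>X = x\<beta>\<gamma>\<beta>\<close>, \<open>Y = y\<gamma>\<beta>\<close>, \<open>Z = z\<beta>\<close>, except that the self-map is still applied to
  \<open>y = Y(\<gamma>\<beta>)\<^sup>-\<^sup>1\<close>; so the self-map that matters is \<open>\<sigma>\<close> composed with an element of \<open>T\<close>.

  Flexibility unwinds in the same way, but the holomorph needs the flexible law of \<open>Q\<close> for
  \<open>\<sigma>\<tau>\<close> with \<^emph>\<open>every\<close> \<open>\<tau> \<in> T\<close>, whereas the hypothesis only supplies \<^emph>\<open>some\<close> twist \<open>\<delta>\<close>.  The
  gap is closed by \<open>generalised_bol_flexible_iff\<close>: in a \<open>\<sigma>\<close>-generalised Bol loop,
  untwisted \<open>\<sigma>\<close>-flexibility is equivalent to the left alternative law \<open>xx\<cdot>z = x\<cdot>xz\<close>, in which \<open>\<sigma>\<close> does not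
  occur.  As \<open>Q\<close> is generalised Bol with respect to every \<open>\<sigma>\<tau>\<close>, flexibility for one twist gives
  the left alternative law, and this in turn gives flexibility for all twists.\<close>

section \<open>Flexibility in generalised Bol loops\<close>

lemma (in loop) right_cancel:
  assumes "x \<otimes> a = y \<otimes> a" "a \<in> carrier Q" "x \<in> carrier Q" "y \<in> carrier Q"
  shows "x = y"
  using r_div[of a "y \<otimes> a"] assms m_closed by blast

text \<open>The Bol identity with equal first two arguments reads
  \<open>(xx\<cdot>z)\<sigma>(x) = x(xz\<cdot>\<sigma>(x))\<close>.  Cancelling \<open>\<sigma>(x)\<close> turns the flexible law for the pair \<open>x, xz\<close>
  into the left alternative law for \<open>x, z\<close>, and every \<open>y\<close> has the form \<open>xz\<close>.\<close>

lemma generalised_bol_flexible_iff: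
  assumes "generalised_bol_loop Q \<sigma>"
  shows "flexible Q \<sigma> \<longleftrightarrow> (\<forall>x\<in>carrier Q. \<forall>z\<in>carrier Q.
    (x \<otimes>\<^bsub>Q\<^esub> x) \<otimes>\<^bsub>Q\<^esub> z = x \<otimes>\<^bsub>Q\<^esub> (x \<otimes>\<^bsub>Q\<^esub> z))" (is "_ \<longleftrightarrow> ?alt")
proof -
  interpret loop Q
    using assms by (simp add: generalised_bol_loop_def)
  have \<sigma>: "\<sigma> x \<in> carrier Q" if "x \<in> carrier Q" for x
    using assms that by (auto simp: generalised_bol_loop_def)
  have bol: "((x \<otimes>\<^bsub>Q\<^esub> x) \<otimes>\<^bsub>Q\<^esub> z) \<otimes>\<^bsub>Q\<^esub> \<sigma> x = x \<otimes>\<^bsub>Q\<^esub> ((x \<otimes>\<^bsub>Q\<^esub> z) \<otimes>\<^bsub>Q\<^esub> \<sigma> x)"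
    if "x \<in> carrier Q" "z \<in> carrier Q" for x z
    using assms that by (simp add: generalised_bol_loop_def)
  show ?thesis
  proof
    assume flex: "flexible Q \<sigma>"
    show ?alt
    proof (intro ballI)
      fix x z assume xz: "x \<in> carrier Q" "z \<in> carrier Q"
      have "((x \<otimes>\<^bsub>Q\<^esub> x) \<otimes>\<^bsub>Q\<^esub> z) \<otimes>\<^bsub>Q\<^esub> \<sigma> x = (x \<otimes>\<^bsub>Q\<^esub> (x \<otimes>\<^bsub>Q\<^esub> z)) \<otimes>\<^bsub>Q\<^esub> \<sigma> x"
        using flex xz by (simp add: bol flexible_def m_closed)
      then show "(x \<otimes>\<^bsub>Q\<^esub> x) \<otimes>\<^bsub>Q\<^esub> z = x \<otimes>\<^bsub>Q\<^esub> (x \<otimes>\<^bsub>Q\<^esub> z)"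
        by (rule right_cancel) (simp_all add: xz \<sigma> m_closed)
    qed
  next
    assume alt: ?alt
    show "flexible Q \<sigma>"
      unfolding flexible_def
    proof (intro ballI)
      fix x y assume xy: "x \<in> carrier Q" "y \<in> carrier Q"
      then obtain z where z: "z \<in> carrier Q" "x \<otimes>\<^bsub>Q\<^esub> z = y"
        using l_div[of x y] by blast
      then show "(x \<otimes>\<^bsub>Q\<^esub> y) \<otimes>\<^bsub>Q\<^esub> \<sigma> x = x \<otimes>\<^bsub>Q\<^esub> (y \<otimes>\<^bsub>Q\<^esub> \<sigma> x)"
        using bol[of x z] alt xy by auto
    qed
  qed
qed

lemma generalised_bol_loop_cong:
  assumes "\<And>x. x \<in> carrier L \<Longrightarrow> \<sigma> x = \<tau> x"
  shows "generalised_bol_loop L \<sigma> \<longleftrightarrow> generalised_bol_loop L \<tau>"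
  using assms by (simp add: generalised_bol_loop_def Pi_iff)

lemma flexible_cong:
  assumes "\<And>x. x \<in> carrier L \<Longrightarrow> \<sigma> x = \<tau> x"
  shows "flexible L \<sigma> \<longleftrightarrow> flexible L \<tau>"
  using assms by (simp add: flexible_def)

section \<open>Automorphism groups of loops\<close>

lemma (in loop) subgroup_auto_SYM: "subgroup (auto Q) (SYM Q)"
proof -
  interpret S: group "SYM Q"
    by (rule group_BijGroup)
  have "(\<lambda>x\<in>carrier Q. x) \<in> auto Q"
    by (simp add: auto_def hom_def id_Bij m_closed)
  moreover have "inv\<^bsub>SYM Q\<^esub> h \<in> auto Q" if "h \<in> auto Q" for h
  proof -
    from that have h: "h \<in> hom Q Q" "h \<in> Bij (carrier Q)"
      by (simp_all add: auto_def)
    have "restrict (inv_into (carrier Q) h) (carrier Q) \<in> hom Q Q"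
      using h by (simp add: hom_def Bij_inv_into_mem m_closed Bij_inv_into_lemma)
    with h show ?thesis
      by (simp add: inv_BijGroup auto_def restrict_inv_into_Bij del: restrict_apply)
  qed
  moreover have "h \<otimes>\<^bsub>SYM Q\<^esub> k \<in> auto Q" if "h \<in> auto Q" "k \<in> auto Q" for h k
  proof -
    have "compose (carrier Q) h k \<in> Bij (carrier Q)"
      using that by (simp add: auto_def compose_Bij)
    moreover have "compose (carrier Q) h k \<in> hom Q Q"
      using that by (simp add: auto_def hom_def compose_def Pi_iff m_closed)
    ultimately show ?thesis
      using that by (simp add: BijGroup_def auto_def)
  qed
  ultimately show ?thesis
    by (intro S.subgroupI) (auto simp: auto_def BijGroup_def)
qed

locale loop_holomorph = loop Q for Q (structure) +
  fixes T :: "('a \<Rightarrow> 'a) set"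
  assumes T_subgroup: "subgroup T (SYM Q)"
    and T_auto: "T \<subseteq> auto Q"

lemma (in loop) loop_holomorphI:
  assumes "subgroup T (AutoGroup Q)"
  shows "loop_holomorph Q T"
proof (intro loop_holomorph.intro loop_holomorph_axioms.intro)
  show "loop Q"
    by (rule loop_axioms)
  show "subgroup T (SYM Q)"
    using group.incl_subgroup[OF group_BijGroup subgroup_auto_SYM] assms
    by (simp add: AutoGroup_def)
  show "T \<subseteq> auto Q"
    using subgroup.subset[OF assms] by (simp add: AutoGroup_def)
qed

section \<open>The holomorph of a loop\<close>

context loop_holomorph
begin

interpretation S: group "SYM Q"
  by (rule group_BijGroup)

lemma T_SYM: "\<alpha> \<in> T \<Longrightarrow> \<alpha> \<in> carrier (SYM Q)"
  using subgroup.subset[OF T_subgroup] by blast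

lemma T_closed: "\<alpha> \<in> T \<Longrightarrow> x \<in> carrier Q \<Longrightarrow> \<alpha> x \<in> carrier Q"
  using T_auto by (auto simp: auto_def hom_def)

lemma T_mult: "\<alpha> \<in> T \<Longrightarrow> x \<in> carrier Q \<Longrightarrow> y \<in> carrier Q \<Longrightarrow> \<alpha> (x \<otimes> y) = \<alpha> x \<otimes> \<alpha> y"
  using T_auto by (auto simp: auto_def hom_def)

lemma T_id: "\<one>\<^bsub>SYM Q\<^esub> \<in> T"
  by (rule subgroup.one_closed[OF T_subgroup])

lemma SYM_one_apply: "x \<in> carrier Q \<Longrightarrow> \<one>\<^bsub>SYM Q\<^esub> x = x"
  by (simp add: BijGroup_def)

lemma T_inv: "\<alpha> \<in> T \<Longrightarrow> inv\<^bsub>SYM Q\<^esub> \<alpha> \<in> T"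
  by (rule subgroup.m_inv_closed[OF T_subgroup])

lemma T_rprod: "\<alpha> \<in> T \<Longrightarrow> \<beta> \<in> T \<Longrightarrow> rprod Q \<alpha> \<beta> \<in> T"
  by (simp add: rprod_def subgroup.m_closed[OF T_subgroup])

lemma rprod_apply: "\<alpha> \<in> T \<Longrightarrow> \<beta> \<in> T \<Longrightarrow> x \<in> carrier Q \<Longrightarrow> rprod Q \<alpha> \<beta> x = \<beta> (\<alpha> x)"
  using T_SYM by (simp add: rprod_def BijGroup_def compose_def)

lemma rprod_assoc:
  "\<alpha> \<in> T \<Longrightarrow> \<beta> \<in> T \<Longrightarrow> \<gamma> \<in> T \<Longrightarrow> rprod Q (rprod Q \<alpha> \<beta>) \<gamma> = rprod Q \<alpha> (rprod Q \<beta> \<gamma>)"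
  by (simp add: rprod_def S.m_assoc T_SYM)

lemma inv_apply:
  assumes "\<alpha> \<in> T" "x \<in> carrier Q"
  shows "(inv\<^bsub>SYM Q\<^esub> \<alpha>) (\<alpha> x) = x"
proof -
  have "(inv\<^bsub>SYM Q\<^esub> \<alpha>) (\<alpha> x) = rprod Q \<alpha> (inv\<^bsub>SYM Q\<^esub> \<alpha>) x"
    using assms by (simp add: rprod_apply T_inv)
  also have "\<dots> = x"
    using assms by (simp add: rprod_def T_SYM SYM_one_apply)
  finally show ?thesis .
qed

lemma T_one: assumes "\<alpha> \<in> T" shows "\<alpha> \<one> = \<one>"
proof (rule right_cancel[of _ "\<alpha> \<one>"])
  show "\<alpha> \<one> \<otimes> \<alpha> \<one> = \<one> \<otimes> \<alpha> \<one>"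
    using T_mult[OF assms, of \<one> \<one>] assms by (simp add: one_closed l_one T_closed)
qed (simp_all add: assms T_closed one_closed)

lemma holomorph_carrier: "carrier (holomorph T Q) = T \<times> carrier Q"
  by (simp add: holomorph_def)

lemma holomorph_mult:
  "(\<alpha>, x) \<otimes>\<^bsub>holomorph T Q\<^esub> (\<beta>, y) = (rprod Q \<alpha> \<beta>, \<beta> x \<otimes> y)"
  by (simp add: holomorph_def)

lemma holomorph_one: "\<one>\<^bsub>holomorph T Q\<^esub> = (\<one>\<^bsub>SYM Q\<^esub>, \<one>)"
  by (simp add: holomorph_def)

lemma loop_holomorph: "loop (holomorph T Q)"
proof
  fix h k assume "h \<in> carrier (holomorph T Q)" "k \<in> carrier (holomorph T Q)"
  then show "h \<otimes>\<^bsub>holomorph T Q\<^esub> k \<in> carrier (holomorph T Q)"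
    by (auto simp: holomorph_carrier holomorph_mult T_rprod T_closed m_closed)
next
  show "\<one>\<^bsub>holomorph T Q\<^esub> \<in> carrier (holomorph T Q)"
    by (simp add: holomorph_carrier holomorph_one T_id one_closed)
next
  fix h assume "h \<in> carrier (holomorph T Q)"
  then show "\<one>\<^bsub>holomorph T Q\<^esub> \<otimes>\<^bsub>holomorph T Q\<^esub> h = h" "h \<otimes>\<^bsub>holomorph T Q\<^esub> \<one>\<^bsub>holomorph T Q\<^esub> = h"
    by (auto simp: holomorph_carrier holomorph_mult holomorph_one rprod_def T_SYM T_one
        SYM_one_apply l_one r_one)
next
  fix h k assume "h \<in> carrier (holomorph T Q)" "k \<in> carrier (holomorph T Q)"
  then obtain \<alpha> x \<gamma> z where hk: "h = (\<alpha>, x)" "k = (\<gamma>, z)"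
    and mem: "\<alpha> \<in> T" "x \<in> carrier Q" "\<gamma> \<in> T" "z \<in> carrier Q"
    by (auto simp: holomorph_carrier)
  define \<beta> where "\<beta> = rprod Q (inv\<^bsub>SYM Q\<^esub> \<alpha>) \<gamma>"
  have \<beta>: "\<beta> \<in> T"
    using mem by (simp add: \<beta>_def T_rprod T_inv)
  have eq_\<beta>: "rprod Q \<alpha> \<beta>' = \<gamma> \<longleftrightarrow> \<beta>' = \<beta>" if "\<beta>' \<in> T" for \<beta>'
    using mem that S.inv_solve_right[of \<beta>' \<gamma> \<alpha>] by (auto simp: \<beta>_def rprod_def T_SYM)
  have "\<exists>!y. y \<in> carrier Q \<and> \<beta> x \<otimes> y = z"
    by (rule l_div[OF T_closed[OF \<beta> mem(2)] mem(4)])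
  then obtain y where y: "y \<in> carrier Q" "\<beta> x \<otimes> y = z"
    and y_unique: "\<And>y'. y' \<in> carrier Q \<Longrightarrow> \<beta> x \<otimes> y' = z \<Longrightarrow> y' = y"
    by blast
  show "\<exists>!m. m \<in> carrier (holomorph T Q) \<and> h \<otimes>\<^bsub>holomorph T Q\<^esub> m = k"
  proof (rule ex1I[of _ "(\<beta>, y)"])
    show "(\<beta>, y) \<in> carrier (holomorph T Q) \<and> h \<otimes>\<^bsub>holomorph T Q\<^esub> (\<beta>, y) = k"
      by (simp add: holomorph_carrier holomorph_mult hk eq_\<beta> \<beta> y)
    fix m assume "m \<in> carrier (holomorph T Q) \<and> h \<otimes>\<^bsub>holomorph T Q\<^esub> m = k"
    then obtain \<beta>' y' where m': "m = (\<beta>', y')" "\<beta>' \<in> T" "y' \<in> carrier Q"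
      "rprod Q \<alpha> \<beta>' = \<gamma>" "\<beta>' x \<otimes> y' = z"
      by (auto simp: holomorph_carrier holomorph_mult hk)
    moreover have "\<beta>' = \<beta>"
      using m' eq_\<beta> by blast
    ultimately show "m = (\<beta>, y)"
      by (simp add: y_unique)
  qed
next
  fix h k assume "h \<in> carrier (holomorph T Q)" "k \<in> carrier (holomorph T Q)"
  then obtain \<beta> y \<gamma> z where hk: "h = (\<beta>, y)" "k = (\<gamma>, z)"
    and mem: "\<beta> \<in> T" "y \<in> carrier Q" "\<gamma> \<in> T" "z \<in> carrier Q"
    by (auto simp: holomorph_carrier)
  define \<alpha> where "\<alpha> = rprod Q \<gamma> (inv\<^bsub>SYM Q\<^esub> \<beta>)"
  have \<alpha>: "\<alpha> \<in> T"
    using mem by (simp add: \<alpha>_def T_rprod T_inv)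
  have eq_\<alpha>: "rprod Q \<alpha>' \<beta> = \<gamma> \<longleftrightarrow> \<alpha>' = \<alpha>" if "\<alpha>' \<in> T" for \<alpha>'
    using mem that S.inv_solve_left[of \<alpha>' \<beta> \<gamma>] by (auto simp: \<alpha>_def rprod_def T_SYM)
  have "\<exists>!w. w \<in> carrier Q \<and> w \<otimes> y = z"
    by (rule r_div[OF mem(2) mem(4)])
  then obtain w where w: "w \<in> carrier Q" "w \<otimes> y = z"
    and w_unique: "\<And>w'. w' \<in> carrier Q \<Longrightarrow> w' \<otimes> y = z \<Longrightarrow> w' = w"
    by blast
  \<comment> \<open>The quotient \<open>w = x\<beta>\<close> in \<open>Q\<close> still has to be pulled back along \<open>\<beta>\<close>.\<close>
  have bij: "bij_betw \<beta> (carrier Q) (carrier Q)"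
    using T_SYM[OF mem(1)] by (simp add: BijGroup_def Bij_def)
  then obtain x where x: "x \<in> carrier Q" "\<beta> x = w"
    using w(1) by (metis bij_betw_def imageE)
  have x_unique: "x' = x" if "x' \<in> carrier Q" "\<beta> x' \<otimes> y = z" for x'
    using w_unique[OF T_closed[OF mem(1)]] that x bij by (metis bij_betw_def inj_onD)
  show "\<exists>!m. m \<in> carrier (holomorph T Q) \<and> m \<otimes>\<^bsub>holomorph T Q\<^esub> h = k"
  proof (rule ex1I[of _ "(\<alpha>, x)"])
    show "(\<alpha>, x) \<in> carrier (holomorph T Q) \<and> (\<alpha>, x) \<otimes>\<^bsub>holomorph T Q\<^esub> h = k"
      by (simp add: holomorph_carrier holomorph_mult hk eq_\<alpha> \<alpha> x w)
    fix m assume "m \<in> carrier (holomorph T Q) \<and> m \<otimes>\<^bsub>holomorph T Q\<^esub> h = k"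
    then obtain \<alpha>' x' where m': "m = (\<alpha>', x')" "\<alpha>' \<in> T" "x' \<in> carrier Q"
      "rprod Q \<alpha>' \<beta> = \<gamma>" "\<beta> x' \<otimes> y = z"
      by (auto simp: holomorph_carrier holomorph_mult hk)
    moreover have "\<alpha>' = \<alpha>"
      using m' eq_\<alpha> by blast
    ultimately show "m = (\<alpha>, x)"
      by (simp add: x_unique)
  qed
qed

lemma holomorph_generalised_bol:
  assumes bol: "\<And>\<tau>. \<tau> \<in> T \<Longrightarrow> generalised_bol_loop Q (\<sigma> \<circ> \<tau>)"
  shows "generalised_bol_loop (holomorph T Q) (map_prod id \<sigma>)"
  unfolding generalised_bol_loop_def holomorph_carrier
proof (intro conjI ballI)
  have \<sigma>: "\<sigma> x \<in> carrier Q" if "x \<in> carrier Q" for x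
    using bol[OF T_id] that by (auto simp: generalised_bol_loop_def SYM_one_apply Pi_iff)
  then show "map_prod id \<sigma> \<in> T \<times> carrier Q \<rightarrow> T \<times> carrier Q"
    by auto
  fix h k l assume "h \<in> T \<times> carrier Q" "k \<in> T \<times> carrier Q" "l \<in> T \<times> carrier Q"
  then obtain \<alpha> x \<beta> y \<gamma> z where hkl: "h = (\<alpha>, x)" "k = (\<beta>, y)" "l = (\<gamma>, z)"
    and mem: "\<alpha> \<in> T" "x \<in> carrier Q" "\<beta> \<in> T" "y \<in> carrier Q" "\<gamma> \<in> T" "z \<in> carrier Q"
    by auto
  define \<tau> where "\<tau> = inv\<^bsub>SYM Q\<^esub> (rprod Q \<gamma> \<beta>)"
  have \<tau>: "\<tau> \<in> T" "\<tau> (\<beta> (\<gamma> y)) = y"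
    using mem inv_apply[of "rprod Q \<gamma> \<beta>" y] by (simp_all add: \<tau>_def T_inv T_rprod rprod_apply)
  have "((\<beta> (\<gamma> (\<beta> x)) \<otimes> \<beta> (\<gamma> y)) \<otimes> \<beta> z) \<otimes> (\<sigma> \<circ> \<tau>) (\<beta> (\<gamma> y))
      = \<beta> (\<gamma> (\<beta> x)) \<otimes> ((\<beta> (\<gamma> y) \<otimes> \<beta> z) \<otimes> (\<sigma> \<circ> \<tau>) (\<beta> (\<gamma> y)))"
    using bol[OF \<tau>(1)] mem T_closed by (simp add: generalised_bol_loop_def)
  then show "((h \<otimes>\<^bsub>holomorph T Q\<^esub> k) \<otimes>\<^bsub>holomorph T Q\<^esub> l) \<otimes>\<^bsub>holomorph T Q\<^esub> map_prod id \<sigma> k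
      = h \<otimes>\<^bsub>holomorph T Q\<^esub> ((k \<otimes>\<^bsub>holomorph T Q\<^esub> l) \<otimes>\<^bsub>holomorph T Q\<^esub> map_prod id \<sigma> k)"
    using mem \<tau>(2)
    by (simp add: hkl holomorph_mult rprod_apply rprod_assoc T_rprod T_mult T_closed m_closed)
qed (rule loop_holomorph)

text \<open>Here the second components reduce to the flexible law of \<open>Q\<close> at \<open>X = x\<beta>\<alpha>\<close>, \<open>Y = y\<alpha>\<close>
  with self-map value \<open>\<sigma>(X(\<beta>\<alpha>)\<^sup>-\<^sup>1)\<close>.  As \<open>\<alpha>\<close> and \<open>\<beta>\<close> vary independently, \<open>(\<beta>\<alpha>)\<^sup>-\<^sup>1\<close> runs
  through all of \<open>T\<close>; hence the assumption on every \<open>\<tau>\<close>.\<close>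

lemma holomorph_flexible:
  assumes flex: "\<And>\<tau>. \<tau> \<in> T \<Longrightarrow> flexible Q (\<sigma> \<circ> \<tau>)"
  shows "flexible (holomorph T Q) (map_prod id \<sigma>)"
  unfolding flexible_def holomorph_carrier
proof (intro ballI)
  fix h k assume "h \<in> T \<times> carrier Q" "k \<in> T \<times> carrier Q"
  then obtain \<alpha> x \<beta> y where hk: "h = (\<alpha>, x)" "k = (\<beta>, y)"
    and mem: "\<alpha> \<in> T" "x \<in> carrier Q" "\<beta> \<in> T" "y \<in> carrier Q"
    by auto
  define \<tau> where "\<tau> = inv\<^bsub>SYM Q\<^esub> (rprod Q \<beta> \<alpha>)"
  have \<tau>: "\<tau> \<in> T" "\<tau> (\<alpha> (\<beta> x)) = x"
    using mem inv_apply[of "rprod Q \<beta> \<alpha>" x] by (simp_all add: \<tau>_def T_inv T_rprod rprod_apply)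
  have "(\<alpha> (\<beta> x) \<otimes> \<alpha> y) \<otimes> (\<sigma> \<circ> \<tau>) (\<alpha> (\<beta> x)) = \<alpha> (\<beta> x) \<otimes> (\<alpha> y \<otimes> (\<sigma> \<circ> \<tau>) (\<alpha> (\<beta> x)))"
    using flex[OF \<tau>(1)] mem T_closed by (simp add: flexible_def)
  then show "(h \<otimes>\<^bsub>holomorph T Q\<^esub> k) \<otimes>\<^bsub>holomorph T Q\<^esub> map_prod id \<sigma> h
      = h \<otimes>\<^bsub>holomorph T Q\<^esub> (k \<otimes>\<^bsub>holomorph T Q\<^esub> map_prod id \<sigma> h)"
    using mem \<tau>(2)
    by (simp add: hk holomorph_mult rprod_apply rprod_assoc T_rprod T_mult T_closed)
qed

text \<open>Through the left alternative law, which does not involve the self-map, flexibility passes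
  from the one twist that is given to all of them.\<close>

lemma twisted_flexible_imp_flexible:
  assumes bol: "\<And>\<tau>. \<tau> \<in> T \<Longrightarrow> generalised_bol_loop Q (\<sigma> \<circ> \<tau>)"
    and flex: "twisted_flexible T Q \<sigma>" and "\<tau> \<in> T"
  shows "flexible Q (\<sigma> \<circ> \<tau>)"
proof -
  obtain \<delta> where "\<delta> \<in> T" "flexible Q (\<sigma> \<circ> \<delta>)"
    using flex by (auto simp: twisted_flexible_def flexible_def)
  then show ?thesis
    using generalised_bol_flexible_iff[OF bol] \<open>\<tau> \<in> T\<close> by blast
qed

end

section \<open>The flexible-Bol property of the holomorph\<close>

theorem corollary3p6:
  fixes Q :: "('a, 'b) monoid_scheme"
    and T :: "('a \<Rightarrow> 'a) set"
    and g :: 'a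
    and \<sigma> :: "'a \<Rightarrow> 'a"
    and \<sigma>' :: "('a \<Rightarrow> 'a) \<times> 'a \<Rightarrow> ('a \<Rightarrow> 'a) \<times> 'a"
  assumes Q: "loop_with_inverses Q"
    and g: "g \<in> carrier Q"
    and \<sigma>: "\<And>x. x \<in> carrier Q \<Longrightarrow> \<sigma> x = inv\<^bsub>Q\<^esub> (x \<otimes>\<^bsub>Q\<^esub> inv\<^bsub>Q\<^esub> g)"
    and T: "T = T3 Q \<or> T = T3_own Q"
    and T_le_AUM: "subgroup T (AutoGroup Q)"
    and \<sigma>': "\<And>\<alpha> x. \<alpha> \<in> T \<Longrightarrow> x \<in> carrier Q \<Longrightarrow>
      \<sigma>' (\<alpha>, x) = (\<alpha>, inv\<^bsub>Q\<^esub> (x \<otimes>\<^bsub>Q\<^esub> inv\<^bsub>Q\<^esub> g))"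
    and bol: "\<And>\<alpha> \<gamma>. \<alpha> \<in> T \<Longrightarrow> \<gamma> \<in> T \<Longrightarrow>
      generalised_bol_loop Q (\<sigma> \<circ> \<alpha> \<circ> inv\<^bsub>SYM Q\<^esub> \<gamma>)"
    and flex: "\<And>\<alpha> \<gamma>. \<alpha> \<in> T \<Longrightarrow> \<gamma> \<in> T \<Longrightarrow>
      twisted_flexible T Q (\<sigma> \<circ> \<alpha> \<circ> inv\<^bsub>SYM Q\<^esub> \<gamma>)"
  shows "generalised_bol_loop (holomorph T Q) \<sigma>' \<and> flexible (holomorph T Q) \<sigma>'"
proof -
  interpret loop_holomorph Q T
    using loop.loop_holomorphI[OF _ T_le_AUM] Q by (simp add: loop_with_inverses_def)
  have inv_id: "inv\<^bsub>SYM Q\<^esub> \<one>\<^bsub>SYM Q\<^esub> = \<one>\<^bsub>SYM Q\<^esub>"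
    by (simp add: monoid.inv_one[OF group.is_monoid[OF group_BijGroup]])
  have bol': "generalised_bol_loop Q (\<sigma> \<circ> \<tau>)" if "\<tau> \<in> T" for \<tau>
    using bol[OF that T_id] generalised_bol_loop_cong[of Q "\<sigma> \<circ> \<tau>" "\<sigma> \<circ> \<tau> \<circ> \<one>\<^bsub>SYM Q\<^esub>"]
    by (simp add: inv_id SYM_one_apply)
  have "twisted_flexible T Q \<sigma>"
    using flex[OF T_id T_id] by (simp add: inv_id SYM_one_apply T_closed twisted_flexible_def)
  then have flex': "flexible Q (\<sigma> \<circ> \<tau>)" if "\<tau> \<in> T" for \<tau>
    using twisted_flexible_imp_flexible[OF bol'] that by blast
  have \<sigma>'_eq: "\<sigma>' h = map_prod id \<sigma> h" if "h \<in> carrier (holomorph T Q)" for h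
    using that by (auto simp: holomorph_carrier \<sigma>' \<sigma>)
  show ?thesis
    using holomorph_generalised_bol[of \<sigma>, OF bol'] holomorph_flexible[of \<sigma>, OF flex']
      generalised_bol_loop_cong[of "holomorph T Q", OF \<sigma>'_eq]
      flexible_cong[of "holomorph T Q", OF \<sigma>'_eq]
    by simp
qed

end
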